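(* For $\mu$-almost every $A\in 2^\omega$, the many-one degree $\deg_m(A)$ contains an infinite antichain of $1$-degrees, i.e. there is an infinite sequence $(B_i)_{i\in\omega}$ of subsets of $\omega$ with $B_i\equiv_m A$ for every $i$ and $B_i\not\le_1 B_j$ for all $i\neq j$. In particular, every Martin-Löf random set $A$ has this property.
   Context: $\omega=\{0,1,2,\dots\}$; sets $A\subseteq\omega$ are identified with their characteristic functions in Cantor space $2^\omega$. For a finite binary string $\sigma$, $[\sigma]=\{X\in 2^\omega:\sigma \text{ is an initial segment of } X\}$, and $\mu$ is the fair-coin product measure on $2^\omega$, determined by $\mu([\sigma])=2^{-|\sigma|}$. For $A,B\subseteq\omega$: $A\le_m B$ if there is a total computable function $f:\omega\to\omega$ such that for all $x$, $x\in A\iff f(x)\in B$; $A\le_1 B$ if there is such an $f$ which is moreover injective. $A\equiv_m B$ means $A\le_m B$ and $B\le_m A$; $A\equiv_1 B$ means $A\le_1 B$ and $B\le_1 A$. $\deg_m(A)=\{X\subseteq\omega: X\equiv_m A\}$ and $\deg_1(A)=\{X\subseteq\omega: X\equiv_1 A\}$. A Martin-Löf test is a sequence $(U_n)_{n\in\omega}$ of uniformly c.e. open subsets of $2^\omega$ (i.e. $U_n=\bigcup_{\sigma\in W_n}[\sigma]$ for a uniformly computably enumerable sequence $(W_n)_{n\in\omega}$ of sets of finite binary strings) such that $\mu(U_n)\le 2^{-n}$ for all $n$. A set $X\in 2^\omega$ is Martin-Löf random if $X\notin\bigcap_n U_n$ for every Martin-Löf test $(U_n)_{n\in\omega}$.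 *)

theory Defs
  imports "HOL-Probability.Probability" "HOL-Library.Nat_Bijection"
begin

section \<open>Computable functions\<close>

text \<open>
  Programs for the partial recursive functions. Programs carry no arity: the same program
  denotes one partial function for each length of its argument list. In \<open>PrimRec\<close> the
  recursion variable and in \<open>Mu\<close> the search variable is the first argument.
\<close>

datatype recf =
    Zero
  | Succ
  | Proj nat
  | Comp recf "recf list"
  | PrimRec recf recf
  | Mu recf

text \<open>
  \<open>None\<close> means divergence (or an argument list that is too short). A composition converges only
  if all inner functions do, and \<open>Mu\<close> returns a zero only if the function converges at all
  smaller arguments.
\<close>

fun eval :: "recf \<Rightarrow> nat list \<Rightarrow> nat option" where
  "eval Zero xs = Some 0"
| "eval Succ xs = (case xs of [] \<Rightarrow> None | x # _ \<Rightarrow> Some (Suc x))"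
| "eval (Proj i) xs = (if i < length xs then Some (xs ! i) else None)"
| "eval (Comp f gs) xs =
     Option.bind (those (map (\<lambda>g. eval g xs) gs)) (\<lambda>ys. eval f ys)"
| "eval (PrimRec f g) xs =
     (case xs of
        [] \<Rightarrow> None
      | n # ys \<Rightarrow>
          rec_nat (eval f ys) (\<lambda>k r. Option.bind r (\<lambda>v. eval g (k # v # ys))) n)"
| "eval (Mu f) xs =
     (if \<exists>y. eval f (y # xs) = Some 0 \<and> (\<forall>z<y. \<exists>v. eval f (z # xs) = Some (Suc v))
      then Some (LEAST y. eval f (y # xs) = Some 0)
      else None)"

definition computable :: "(nat \<Rightarrow> nat) \<Rightarrow> bool" where
  "computable f \<longleftrightarrow> (\<exists>e. \<forall>x. eval e [x] = Some (f x))"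

section \<open>Many-one and one-one reducibility\<close>

text \<open>Subsets of \<open>\<omega>\<close> are identified with their characteristic functions.\<close>

type_synonym cantor = "nat \<Rightarrow> bool"

definition m_reducible :: "cantor \<Rightarrow> cantor \<Rightarrow> bool" (infix "\<le>\<^sub>m" 50) where
  "A \<le>\<^sub>m B \<longleftrightarrow> (\<exists>f. computable f \<and> (\<forall>x. A x \<longleftrightarrow> B (f x)))"

definition one_reducible :: "cantor \<Rightarrow> cantor \<Rightarrow> bool" (infix "\<le>\<^sub>1" 50) where
  "A \<le>\<^sub>1 B \<longleftrightarrow> (\<exists>f. computable f \<and> inj f \<and> (\<forall>x. A x \<longleftrightarrow> B (f x)))"

definition m_equivalent :: "cantor \<Rightarrow> cantor \<Rightarrow> bool" (infix "\<equiv>\<^sub>m" 50) where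
  "A \<equiv>\<^sub>m B \<longleftrightarrow> A \<le>\<^sub>m B \<and> B \<le>\<^sub>m A"

definition m_degree :: "cantor \<Rightarrow> cantor set" where
  "m_degree A = {X. X \<equiv>\<^sub>m A}"

section \<open>Cantor space and Martin-Loef randomness\<close>

definition cylinder :: "bool list \<Rightarrow> cantor set" where
  "cylinder \<sigma> = {X. \<forall>i<length \<sigma>. X i = \<sigma> ! i}"

definition coin_measure :: "cantor measure" where
  "coin_measure = PiM UNIV (\<lambda>_. measure_pmf (bernoulli_pmf (1/2)))"

text \<open>
  Domain of a single binary partial recursive function; strings are coded as lists of bits by
  the primitive recursive pairing-based bijection \<^const>\<open>list_encode\<close>.
\<close>

definition uniformly_ce :: "(nat \<Rightarrow> bool list set) \<Rightarrow> bool" where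
  "uniformly_ce W \<longleftrightarrow>
     (\<exists>e. \<forall>n \<sigma>. \<sigma> \<in> W n \<longleftrightarrow> eval e [n, list_encode (map of_bool \<sigma>)] \<noteq> None)"

definition martin_loef_test :: "(nat \<Rightarrow> cantor set) \<Rightarrow> bool" where
  "martin_loef_test U \<longleftrightarrow>
     (\<exists>W. uniformly_ce W \<and> (\<forall>n. U n = (\<Union>\<sigma>\<in>W n. cylinder \<sigma>))) \<and>
     (\<forall>n. measure coin_measure (U n) \<le> 1 / 2 ^ n)"

definition martin_loef_random :: "cantor \<Rightarrow> bool" where
  "martin_loef_random X \<longleftrightarrow> (\<forall>U. martin_loef_test U \<longrightarrow> X \<notin> (\<Inter>n. U n))"

lemma prob_space_coin_measure: "prob_space coin_measure"
  unfolding coin_measure_def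
  by (intro prob_space_PiM prob_space_measure_pmf)

lemma space_coin_measure [simp]: "space coin_measure = UNIV"
  by (simp add: coin_measure_def space_PiM PiE_def extensional_def Pi_def)

lemma cylinder_eq_prod_emb:
  "cylinder \<sigma> = prod_emb UNIV (\<lambda>_. measure_pmf (bernoulli_pmf (1/2))) {..<length \<sigma>}
     (\<Pi>\<^sub>E i\<in>{..<length \<sigma>}. {\<sigma> ! i})"
  by (auto simp: cylinder_def prod_emb_def PiE_def Pi_def extensional_def restrict_def)

lemma sets_cylinder: "cylinder \<sigma> \<in> sets coin_measure"
  unfolding cylinder_eq_prod_emb coin_measure_def
  by (intro sets_PiM_I) auto

text \<open>The property by which the fair-coin measure is determined.\<close>

lemma measure_cylinder: "measure coin_measure (cylinder \<sigma>) = 1 / 2 ^ length \<sigma>"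
proof -
  interpret product_prob_space "\<lambda>_::nat. measure_pmf (bernoulli_pmf (1/2))" UNIV
    by standard
  have "measure coin_measure (cylinder \<sigma>) =
      (\<Prod>i<length \<sigma>. measure (measure_pmf (bernoulli_pmf (1/2))) {\<sigma> ! i})"
    unfolding cylinder_eq_prod_emb coin_measure_def
    by (rule measure_PiM_emb) auto
  also have "\<dots> = (\<Prod>i<length \<sigma>. 1 / 2)"
  proof (rule prod.cong [OF refl])
    fix i
    show "measure (measure_pmf (bernoulli_pmf (1/2))) {\<sigma> ! i} = 1 / 2"
      by (cases "\<sigma> ! i") (simp_all add: measure_pmf_single)
  qed
  also have "\<dots> = 1 / 2 ^ length \<sigma>"
    by (simp add: power_divide)
  finally show ?thesis .
qed

end

theory Submission
  imports Defs
begin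

text \<open>
  Let \<open>A\<close> be random and \<open>g\<close>, \<open>h\<close> computable with \<open>A \<circ> g = A \<circ> h\<close>. If \<open>g\<close> and \<open>h\<close> differed at
  arguments with arbitrarily large values, one could compute an infinite sequence of pairs
  \<open>{g x, h x}\<close> each containing a new number; every pair halves the measure of the sets that do not
  separate it, which gives a Martin-Loef test catching \<open>A\<close>. So \<open>g x = h x\<close> unless both are below some
  bound. Take \<open>B\<^sub>i = A \<circ> s\<^sub>i\<close> for a computable surjection \<open>s\<^sub>i\<close> that hits the numbers of 2-adic valuation
  \<open>i\<close> twice and all others once. A one-one reduction \<open>f\<close> of \<open>B\<^sub>i\<close> to \<open>B\<^sub>j\<close> satisfies \<open>s\<^sub>i = s\<^sub>j \<circ> f\<close> above
  the bound, so there the fibres of \<open>s\<^sub>i\<close> inject into those of \<open>s\<^sub>j\<close>, which forces \<open>i = j\<close>.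
\<close>

section \<open>Closure properties of the total computable functions\<close>

text \<open>Passing the arguments as one list makes the closure rules independent of the arity: a
  term in the entries \<open>xs ! i\<close> is taken apart by syntax-directed introduction.\<close>

definition total_rec :: "nat \<Rightarrow> (nat list \<Rightarrow> nat) \<Rightarrow> bool" where
  "total_rec k F \<longleftrightarrow> (\<exists>e. \<forall>xs. length xs = k \<longrightarrow> eval e xs = Some (F xs))"

abbreviation total_rec1 :: "(nat \<Rightarrow> nat) \<Rightarrow> bool" where
  "total_rec1 f \<equiv> total_rec 1 (\<lambda>xs. f (xs ! 0))"

abbreviation total_rec2 :: "(nat \<Rightarrow> nat \<Rightarrow> nat) \<Rightarrow> bool" where
  "total_rec2 f \<equiv> total_rec 2 (\<lambda>xs. f (xs ! 0) (xs ! 1))"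

abbreviation total_rec3 :: "(nat \<Rightarrow> nat \<Rightarrow> nat \<Rightarrow> nat) \<Rightarrow> bool" where
  "total_rec3 f \<equiv> total_rec 3 (\<lambda>xs. f (xs ! 0) (xs ! 1) (xs ! 2))"

lemma length_eq_1_iff: "length xs = 1 \<longleftrightarrow> (\<exists>x. xs = [x])"
  by (auto simp: length_Suc_conv)

lemma length_eq_2_iff: "length xs = 2 \<longleftrightarrow> (\<exists>x y. xs = [x, y])"
  by (auto simp: length_Suc_conv numeral_2_eq_2)

lemma total_rec1_iff: "total_rec1 f \<longleftrightarrow> (\<exists>e. \<forall>x. eval e [x] = Some (f x))"
  unfolding total_rec_def length_eq_1_iff by (rule ex_cong1) auto

lemma total_rec1_iff_computable: "total_rec1 f \<longleftrightarrow> computable f"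
  unfolding total_rec1_iff computable_def ..

lemma total_rec2_iff: "total_rec2 f \<longleftrightarrow> (\<exists>e. \<forall>x y. eval e [x, y] = Some (f x y))"
  unfolding total_rec_def length_eq_2_iff by (rule ex_cong1) auto

lemma total_rec3D:
  assumes "total_rec3 f"
  obtains e where "\<And>x y z. eval e [x, y, z] = Some (f x y z)"
proof -
  obtain e where e: "\<And>xs. length xs = 3 \<Longrightarrow> eval e xs = Some (f (xs ! 0) (xs ! 1) (xs ! 2))"
    using assms unfolding total_rec_def by auto
  show ?thesis
    by (rule that[of e]) (simp add: e)
qed

named_theorems rec_intros

lemma total_rec_nth [rec_intros]: "i < k \<Longrightarrow> total_rec k (\<lambda>xs. xs ! i)"
  unfolding total_rec_def by (intro exI[of _ "Proj i"]) auto

lemma total_rec_comp1: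
  assumes "total_rec1 f" "total_rec k a"
  shows "total_rec k (\<lambda>xs. f (a xs))"
proof -
  obtain e where e: "\<And>x. eval e [x] = Some (f x)"
    using assms(1) total_rec1_iff by auto
  obtain ea where ea: "\<And>xs. length xs = k \<Longrightarrow> eval ea xs = Some (a xs)"
    using assms(2) unfolding total_rec_def by auto
  show ?thesis
    unfolding total_rec_def by (intro exI[of _ "Comp e [ea]"]) (simp add: e ea)
qed

lemma total_rec_comp2:
  assumes "total_rec2 f" "total_rec k a" "total_rec k b"
  shows "total_rec k (\<lambda>xs. f (a xs) (b xs))"
proof -
  obtain e where e: "\<And>x y. eval e [x, y] = Some (f x y)"
    using assms(1) total_rec2_iff by auto
  obtain ea where ea: "\<And>xs. length xs = k \<Longrightarrow> eval ea xs = Some (a xs)"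
    using assms(2) unfolding total_rec_def by auto
  obtain eb where eb: "\<And>xs. length xs = k \<Longrightarrow> eval eb xs = Some (b xs)"
    using assms(3) unfolding total_rec_def by auto
  show ?thesis
    unfolding total_rec_def by (intro exI[of _ "Comp e [ea, eb]"]) (simp add: e ea eb)
qed

lemma total_rec_Suc [rec_intros]:
  assumes "total_rec k a"
  shows "total_rec k (\<lambda>xs. Suc (a xs))"
proof (rule total_rec_comp1[OF _ assms])
  show "total_rec1 Suc"
    unfolding total_rec1_iff by (intro exI[of _ Succ]) simp
qed

lemma total_rec_const [rec_intros]: "total_rec k (\<lambda>_. c)"
proof (induction c)
  case 0
  show ?case
    unfolding total_rec_def by (intro exI[of _ Zero]) simp
next
  case (Suc c)
  then show ?case
    by (rule total_rec_Suc)
qed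

lemma total_rec2_rec_nat:
  assumes "total_rec1 a" "total_rec3 G"
  shows "total_rec2 (\<lambda>n x. rec_nat (a x) (\<lambda>i r. G i r x) n)"
proof -
  obtain ea where ea: "\<And>x. eval ea [x] = Some (a x)"
    using assms(1) total_rec1_iff by auto
  obtain eG where eG: "\<And>x y z. eval eG [x, y, z] = Some (G x y z)"
    using assms(2) total_rec3D by blast
  have "rec_nat (Some (a x)) (\<lambda>i r. Option.bind r (\<lambda>v. eval eG [i, v, x])) n =
      Some (rec_nat (a x) (\<lambda>i r. G i r x) n)" for n x
    by (induction n) (simp_all add: eG)
  then show ?thesis
    unfolding total_rec2_iff[of "\<lambda>n x. rec_nat (a x) (\<lambda>i r. G i r x) n"]
    by (intro exI[of _ "PrimRec ea eG"]) (simp add: ea)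
qed

lemma total_rec1_rec_nat:
  assumes "total_rec2 G"
  shows "total_rec1 (\<lambda>n. rec_nat c (\<lambda>i r. G i r) n)"
proof -
  \<comment> \<open>Recursion without a parameter is run with a dummy one, afterwards set to
    \<open>0\<close>.\<close>
  have "total_rec2 (\<lambda>n x. rec_nat c (\<lambda>i r. G i r) n)"
    by (intro total_rec2_rec_nat total_rec_comp2[OF assms] rec_intros) simp_all
  from total_rec_comp2[OF this, of 1 "\<lambda>xs. xs ! 0" "\<lambda>_. 0"] show ?thesis
    by (simp add: rec_intros)
qed

lemma total_rec1_Least:
  assumes "total_rec2 Z" and zero: "\<And>x. \<exists>y. Z y x = 0"
  shows "total_rec1 (\<lambda>x. LEAST y. Z y x = 0)"
proof -
  obtain e where e: "\<And>x y. eval e [x, y] = Some (Z x y)"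
    using assms(1) total_rec2_iff by auto
  \<comment> \<open>Below the least zero all values are successors, which is what \<open>Mu\<close>
    asks for.\<close>
  have "\<exists>y. Z y x = 0 \<and> (\<forall>z<y. \<exists>v. Z z x = Suc v)" for x
    using exists_least_iff[of "\<lambda>y. Z y x = 0"] zero by (meson not0_implies_Suc)
  then show ?thesis
    unfolding total_rec1_iff[of "\<lambda>x. LEAST y. Z y x = 0"]
    by (intro exI[of _ "Mu e"]) (simp add: e)
qed

section \<open>Arithmetic functions\<close>

lemma total_rec_add [rec_intros]:
  assumes "total_rec k a" "total_rec k b"
  shows "total_rec k (\<lambda>xs. a xs + b xs)"
proof (rule total_rec_comp2[OF _ assms])
  have "total_rec2 (\<lambda>n x. rec_nat x (\<lambda>i r. Suc r) n)"
    by (intro total_rec2_rec_nat rec_intros) simp_all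
  moreover have "rec_nat x (\<lambda>i r. Suc r) n = n + x" for n x :: nat
    by (induction n) simp_all
  ultimately show "total_rec2 (+)"
    by simp
qed

lemma total_rec_mult [rec_intros]:
  assumes "total_rec k a" "total_rec k b"
  shows "total_rec k (\<lambda>xs. a xs * b xs)"
proof (rule total_rec_comp2[OF _ assms])
  have "total_rec2 (\<lambda>n x. rec_nat 0 (\<lambda>i r. r + x) n)"
    by (intro total_rec2_rec_nat rec_intros) simp_all
  moreover have "rec_nat 0 (\<lambda>i r. r + x) n = n * x" for n x :: nat
    by (induction n) simp_all
  ultimately show "total_rec2 (*)"
    by simp
qed

lemma total_rec_diff [rec_intros]:
  assumes "total_rec k a" "total_rec k b"
  shows "total_rec k (\<lambda>xs. a xs - b xs)"
proof (rule total_rec_comp2[OF _ assms])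
  \<comment> \<open>The predecessor is the recursion that returns its counter; iterating it
    subtracts. The recursion variable is the subtrahend, so the arguments are swapped at the
    end.\<close>
  have "total_rec1 (\<lambda>n. rec_nat 0 (\<lambda>i r. i) n)"
    by (intro total_rec1_rec_nat rec_intros) simp_all
  moreover have "rec_nat 0 (\<lambda>i r. i) n = n - 1" for n :: nat
    by (induction n) simp_all
  ultimately have "total_rec1 (\<lambda>n. n - 1)"
    by simp
  note pred = total_rec_comp1[OF this]
  have "total_rec2 (\<lambda>n x. rec_nat x (\<lambda>i r. r - 1) n)"
    by (intro total_rec2_rec_nat pred rec_intros) simp_all
  moreover have "rec_nat x (\<lambda>i r. r - 1) n = x - n" for n x :: nat
    by (induction n) simp_all
  ultimately have "total_rec2 (\<lambda>n x. x - n)"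
    by simp
  from total_rec_comp2[OF this, of 2 "\<lambda>xs. xs ! 1" "\<lambda>xs. xs ! 0"] show "total_rec2 (-)"
    by (simp add: rec_intros)
qed

lemma total_rec_mod2 [rec_intros]:
  assumes "total_rec k a"
  shows "total_rec k (\<lambda>xs. a xs mod 2)"
proof (rule total_rec_comp1[OF _ assms])
  have "total_rec1 (\<lambda>n. rec_nat 0 (\<lambda>i r. 1 - r) n)"
    by (intro total_rec1_rec_nat rec_intros) simp_all
  moreover have "rec_nat 0 (\<lambda>i r. 1 - r) n = n mod 2" for n :: nat
    by (induction n) (simp_all add: mod_Suc)
  ultimately show "total_rec1 (\<lambda>n. n mod 2)"
    by simp
qed

lemma total_rec_div2 [rec_intros]:
  assumes "total_rec k a"
  shows "total_rec k (\<lambda>xs. a xs div 2)"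
proof (rule total_rec_comp1[OF _ assms])
  \<comment> \<open>Passing from \<open>i\<close> to \<open>Suc i\<close> raises the half by one
    exactly if \<open>i\<close> is odd.\<close>
  have "total_rec1 (\<lambda>n. rec_nat 0 (\<lambda>i r. r + i mod 2) n)"
    by (intro total_rec1_rec_nat rec_intros) simp_all
  moreover have "rec_nat 0 (\<lambda>i r. r + i mod 2) n = n div 2" for n :: nat
  proof (induction n)
    case (Suc n)
    then show ?case
      by simp presburger
  qed simp
  ultimately show "total_rec1 (\<lambda>n. n div 2)"
    by simp
qed

section \<open>Decoding of pairs and lists\<close>

lemma total_rec_triangle [rec_intros]:
  assumes "total_rec k a"
  shows "total_rec k (\<lambda>xs. triangle (a xs))"
proof (rule total_rec_comp1[OF _ assms])
  have "total_rec1 (\<lambda>n. rec_nat 0 (\<lambda>i r. r + Suc i) n)"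
    by (intro total_rec1_rec_nat rec_intros) simp_all
  moreover have "rec_nat 0 (\<lambda>i r. r + Suc i) n = triangle n" for n :: nat
    by (induction n) simp_all
  ultimately show "total_rec1 triangle"
    by simp
qed

lemma mono_triangle: "mono triangle"
  by (rule mono_iff_le_Suc[THEN iffD2]) simp

text \<open>The diagonal on which \<open>m\<close> lies is found by unbounded search.\<close>

lemma prod_decode_Least:
  fixes m :: nat
  defines "k \<equiv> LEAST k. Suc m - triangle (Suc k) = 0"
  shows "fst (prod_decode m) = m - triangle k" "snd (prod_decode m) = k - (m - triangle k)"
proof -
  obtain a b where ab: "prod_decode m = (a, b)"
    by fastforce
  then have m: "m = triangle (a + b) + a"
    using prod_decode_inverse[of m] by (simp add: prod_encode_def)
  \<comment> \<open>\<open>Suc m - triangle (Suc y) = 0\<close> says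
    \<open>m < triangle (Suc y)\<close>; the least such \<open>y\<close> is the diagonal
    \<open>a + b\<close>, as \<open>triangle (a + b) \<le> m\<close>.\<close>
  have "k = a + b"
    unfolding k_def
  proof (rule Least_equality)
    show "Suc m - triangle (Suc (a + b)) = 0"
      by (simp add: m)
    fix y
    assume y: "Suc m - triangle (Suc y) = 0"
    show "a + b \<le> y"
    proof (rule ccontr)
      assume "\<not> a + b \<le> y"
      then have "triangle (Suc y) \<le> triangle (a + b)"
        by (intro monoD[OF mono_triangle]) simp
      with y m show False
        by simp
    qed
  qed
  with ab m show "fst (prod_decode m) = m - triangle k"
    "snd (prod_decode m) = k - (m - triangle k)"
    by simp_all
qed

lemma total_rec_prod_decode [rec_intros]:
  assumes "total_rec k a"
  shows "total_rec k (\<lambda>xs. fst (prod_decode (a xs)))"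
    and "total_rec k (\<lambda>xs. snd (prod_decode (a xs)))"
proof -
  have "\<exists>y. Suc x - triangle (Suc y) = 0" for x
    by (intro exI[of _ x]) simp
  then have diag: "total_rec1 (\<lambda>m. LEAST k. Suc m - triangle (Suc k) = 0)"
    by (intro total_rec1_Least rec_intros) simp_all
  note * = total_rec_comp1[OF diag]
  show "total_rec k (\<lambda>xs. fst (prod_decode (a xs)))"
    "total_rec k (\<lambda>xs. snd (prod_decode (a xs)))"
    unfolding prod_decode_Least by (intro rec_intros * assms)+
qed

text \<open>A nonempty list has code \<open>Suc (prod_encode (x, c))\<close> with \<open>x\<close>
  its head and \<open>c\<close> the code of its tail, so each step removes a head.\<close>

definition drop_code :: "nat \<Rightarrow> nat \<Rightarrow> nat" where
  "drop_code a c = rec_nat c (\<lambda>i r. snd (prod_decode (r - 1))) a"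

lemma total_rec_drop_code [rec_intros]:
  assumes "total_rec k a" "total_rec k b"
  shows "total_rec k (\<lambda>xs. drop_code (a xs) (b xs))"
proof (rule total_rec_comp2[OF _ assms])
  show "total_rec2 drop_code"
    unfolding drop_code_def by (intro total_rec2_rec_nat rec_intros) simp_all
qed

lemma drop_code_list_encode: "drop_code a (list_encode l) = list_encode (drop a l)"
proof (induction a)
  case 0
  show ?case
    by (simp add: drop_code_def)
next
  case (Suc a)
  \<comment> \<open>The empty list has code \<open>0\<close>; as \<open>0 - 1 = 0\<close> decodes to
    \<open>(0, 0)\<close>, its tail again gets code \<open>0\<close>, matching
    \<open>tl [] = []\<close>.\<close>
  have "prod_decode 0 = (0, 0)"
    by (simp add: prod_decode_def prod_decode_aux.simps)
  then have "snd (prod_decode (list_encode l' - 1)) = list_encode (tl l')" for l'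
    by (cases l') simp_all
  with Suc show ?case
    by (simp add: drop_code_def drop_Suc tl_drop)
qed

section \<open>Agreement of a random set along two computable functions\<close>

text \<open>A conjunction of tests as a sum that is zero iff each term is. On the code of a string,
  the first two terms test that the positions \<open>u\<close> and \<open>v\<close> exist
  (\<open>drop_code\<close> is then nonzero), and the last two form the absolute difference of the
  bits there.\<close>

definition disagree :: "nat \<Rightarrow> nat \<Rightarrow> nat \<Rightarrow> nat" where
  "disagree u v c = (1 - drop_code u c) + (1 - drop_code v c)
     + (fst (prod_decode (drop_code u c - 1)) - fst (prod_decode (drop_code v c - 1)))
     + (fst (prod_decode (drop_code v c - 1)) - fst (prod_decode (drop_code u c - 1)))"

lemma disagree_eq_0_iff:
  "disagree u v (list_encode (map of_bool \<sigma>)) = 0 \<longleftrightarrow>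
     u < length \<sigma> \<and> v < length \<sigma> \<and> \<sigma> ! u = \<sigma> ! v"
proof -
  have nonempty: "Suc 0 \<le> list_encode (drop u (map of_bool \<sigma>)) \<longleftrightarrow> u < length \<sigma>" for u
    by (cases "u < length \<sigma>") (simp_all add: Cons_nth_drop_Suc[symmetric])
  have bit: "fst (prod_decode (list_encode (drop u (map of_bool \<sigma>)) - Suc 0)) = of_bool (\<sigma> ! u)"
    if "u < length \<sigma>" for u
    using that by (simp add: Cons_nth_drop_Suc[symmetric])
  show ?thesis
    unfolding disagree_def drop_code_list_encode
    by (cases "u < length \<sigma>"; cases "v < length \<sigma>") (auto simp: bit nonempty)
qed

lemma uniformly_ceI:
  assumes S: "total_rec2 S" and W: "\<And>n \<sigma>. \<sigma> \<in> W n \<longleftrightarrow> S n (list_encode (map of_bool \<sigma>)) = 0"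
  shows "uniformly_ce W"
proof -
  obtain e where e: "\<And>x y. eval e [x, y] = Some (S x y)"
    using S total_rec2_iff by auto
  \<comment> \<open>The search variable is ignored, so the search stops at \<open>0\<close> or
    never.\<close>
  show ?thesis
    unfolding uniformly_ce_def
    by (intro exI[of _ "Mu (Comp e [Proj 1, Proj 2])"]) (auto simp: e W)
qed

lemma uniformly_ce_agree:
  assumes g: "total_rec1 g" and h: "total_rec1 h"
  shows "uniformly_ce (\<lambda>n. {\<sigma>. \<forall>k<n. g k < length \<sigma> \<and> h k < length \<sigma> \<and> \<sigma> ! g k = \<sigma> ! h k})"
proof (rule uniformly_ceI)
  \<comment> \<open>The bounded quantifier over \<open>k\<close> becomes a sum, computed by
    recursion on \<open>n\<close>.\<close>
  let ?S = "\<lambda>n c. rec_nat 0 (\<lambda>k r. r + disagree (g k) (h k) c) n"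
  show "total_rec2 ?S"
    unfolding disagree_def
    by (intro total_rec2_rec_nat rec_intros total_rec_comp1[OF g] total_rec_comp1[OF h]) simp_all
  fix n \<sigma>
  have "?S n c = 0 \<longleftrightarrow> (\<forall>k<n. disagree (g k) (h k) c = 0)" for c
    by (induction n) (auto simp: less_Suc_eq)
  then show "\<sigma> \<in> {\<sigma>. \<forall>k<n. g k < length \<sigma> \<and> h k < length \<sigma> \<and> \<sigma> ! g k = \<sigma> ! h k} \<longleftrightarrow>
      ?S n (list_encode (map of_bool \<sigma>)) = 0"
    by (simp add: disagree_eq_0_iff)
qed

section \<open>Invariance of the coin measure under flipping a bit\<close>

definition flip :: "nat \<Rightarrow> cantor \<Rightarrow> cantor" where
  "flip u X = X(u := \<not> X u)"

lemma sets_coordinate: "{X. P (X i)} \<in> sets coin_measure"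
proof -
  have "(\<lambda>X. X i) \<in> measurable coin_measure (measure_pmf (bernoulli_pmf (1/2)))"
    unfolding coin_measure_def by (rule measurable_component_singleton) simp
  from measurable_sets[OF this, of "{b. P b}"] show ?thesis
    by (simp add: vimage_def)
qed

lemma sets_agree: "{X. X i = X j} \<in> sets coin_measure"
proof -
  have "{X. X i = X j} = ({X. X i} \<inter> {X. X j}) \<union> ({X. \<not> X i} \<inter> {X. \<not> X j})"
    by auto
  also have "\<dots> \<in> sets coin_measure"
    by (intro sets.Un sets.Int sets_coordinate)
  finally show ?thesis .
qed

lemma measurable_flip: "flip u \<in> measurable coin_measure coin_measure"
proof -
  have "(\<lambda>X. flip u X i) \<in> measurable coin_measure (measure_pmf (bernoulli_pmf (1/2)))" for i
  proof (rule measurableI)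
    fix A :: "bool set"
    have "(\<lambda>X. flip u X i) -` A \<inter> space coin_measure = {X. (if i = u then \<not> X i else X i) \<in> A}"
      by (auto simp: flip_def)
    also have "\<dots> \<in> sets coin_measure"
      by (rule sets_coordinate)
    finally show "(\<lambda>X. flip u X i) -` A \<inter> space coin_measure \<in> sets coin_measure" .
  qed simp
  then show ?thesis
    unfolding coin_measure_def by (intro measurable_PiM_single') (auto simp: PiE_def)
qed

text \<open>A product measure is determined by its values on finite boxes. Flipping turns the factor
  at \<open>u\<close> into its preimage under \<open>Not\<close>, which has the same probability for
  a fair coin.\<close>

lemma distr_flip: "distr coin_measure coin_measure (flip u) = coin_measure"
proof -
  let ?B = "\<lambda>_::nat. measure_pmf (bernoulli_pmf (1/2))"
  interpret product_prob_space ?B UNIV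
    by standard
  have emb: "emeasure coin_measure (prod_emb UNIV ?B J (Pi\<^sub>E J F)) = (\<Prod>j\<in>J. emeasure (?B j) (F j))"
    if "finite J" for J F
    unfolding coin_measure_def using that by (intro emeasure_PiM_emb) auto
  have "distr coin_measure coin_measure (flip u) = PiM UNIV ?B"
  proof (rule PiM_eq)
    fix J :: "nat set" and F :: "nat \<Rightarrow> bool set"
    assume J: "finite J"
    define F' where "F' = F(u := Not -` F u)"
    have half: "emeasure (?B j) (Not -` F j) = emeasure (?B j) (F j)" for j
    proof -
      have "map_pmf Not (bernoulli_pmf (1/2)) = bernoulli_pmf (1/2)"
      proof (rule pmf_eqI)
        fix b
        have "Not -` {b} = {\<not> b}"
          by auto
        then show "pmf (map_pmf Not (bernoulli_pmf (1/2))) b = pmf (bernoulli_pmf (1/2)) b"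
          by (cases b) (simp_all add: pmf_map measure_pmf_single)
      qed
      then have "emeasure (?B j) (F j) = emeasure (map_pmf Not (bernoulli_pmf (1/2))) (F j)"
        by simp
      also have "\<dots> = emeasure (?B j) (Not -` F j)"
        by simp
      finally show ?thesis ..
    qed
    have "flip u -` prod_emb UNIV ?B J (Pi\<^sub>E J F) = prod_emb UNIV ?B J (Pi\<^sub>E J F')"
    proof -
      have mem: "X \<in> prod_emb UNIV ?B J (Pi\<^sub>E J G) \<longleftrightarrow> (\<forall>j\<in>J. X j \<in> G j)" for X G
        by (simp add: prod_emb_def PiE_def Pi_def extensional_def restrict_def Ball_def)
      have "flip u X j \<in> F j \<longleftrightarrow> X j \<in> F' j" for X j
        by (simp add: flip_def F'_def)
      then show ?thesis
        by (auto simp only: mem vimage_eq)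
    qed
    then have "emeasure (distr coin_measure coin_measure (flip u)) (prod_emb UNIV ?B J (Pi\<^sub>E J F))
        = emeasure coin_measure (prod_emb UNIV ?B J (Pi\<^sub>E J F'))"
      using J by (subst emeasure_distr[OF measurable_flip])
        (auto simp: coin_measure_def intro!: sets_PiM_I)
    also have "\<dots> = (\<Prod>j\<in>J. emeasure (?B j) (F j))"
      unfolding emb[OF J] by (intro prod.cong) (auto simp: F'_def half)
    finally show "emeasure (distr coin_measure coin_measure (flip u)) (prod_emb UNIV ?B J (Pi\<^sub>E J F))
        = (\<Prod>j\<in>J. emeasure (?B j) (F j))" .
  qed (simp add: coin_measure_def)
  then show ?thesis
    by (simp add: coin_measure_def)
qed

lemma measure_flip:
  assumes "E \<in> sets coin_measure"
  shows "measure coin_measure (flip u -` E) = measure coin_measure E"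
  using measure_distr[OF measurable_flip assms, of u] by (simp add: distr_flip)

text \<open>The position \<open>max (g n) (h n)\<close> occurs in no earlier pair and on exactly one
  side of the pair \<open>n\<close>. Flipping it preserves agreement on the first \<open>n\<close>
  pairs and exchanges agreement with disagreement on the pair \<open>n\<close>, so each further pair
  halves the measure.\<close>

lemma measure_agree:
  fixes g h :: "nat \<Rightarrow> nat"
  assumes ne: "\<And>k. g k \<noteq> h k" and mono: "strict_mono (\<lambda>k. max (g k) (h k))"
  shows "measure coin_measure {X. \<forall>k<n. X (g k) = X (h k)} = 1 / 2 ^ n"
proof (induction n)
  case 0
  interpret prob_space coin_measure
    by (rule prob_space_coin_measure)
  show ?case
    using prob_space by simp
next
  case (Suc n)
  interpret prob_space coin_measure
    by (rule prob_space_coin_measure)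
  define E where "E n = {X :: cantor. \<forall>k<n. X (g k) = X (h k)}" for n :: nat
  have E_Int: "E m = (\<Inter>k\<in>{..<m}. {X. X (g k) = X (h k)})" for m
    by (auto simp: E_def)
  have E: "E m \<in> sets coin_measure" for m
    unfolding E_Int using sets.top[of coin_measure]
    by (intro sets.countable_INT'' sets_agree) simp_all
  define u where "u = max (g n) (h n)"
  have u: "g k < u" "h k < u" if "k < n" for k
    using strict_monoD[OF mono that] by (simp_all add: u_def)
  have "flip u X \<in> E n \<longleftrightarrow> X \<in> E n" for X
    using u by (auto simp: E_def flip_def)
  moreover have "flip u X (g n) = flip u X (h n) \<longleftrightarrow> X (g n) \<noteq> X (h n)" for X
    using ne[of n] by (cases "g n \<le> h n") (auto simp: u_def flip_def)
  moreover have Suc_iff: "X \<in> E (Suc n) \<longleftrightarrow> X \<in> E n \<and> X (g n) = X (h n)" for X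
    by (auto simp: E_def less_Suc_eq)
  ultimately have "flip u -` E (Suc n) = E n - E (Suc n)"
    by (simp add: set_eq_iff) blast
  then have "measure coin_measure (E (Suc n)) = measure coin_measure (E n - E (Suc n))"
    using measure_flip[OF E, of u "Suc n"] by simp
  also have "\<dots> = measure coin_measure (E n) - measure coin_measure (E (Suc n))"
    using Suc_iff by (intro finite_measure_Diff E) auto
  finally show ?case
    using Suc unfolding E_def by simp
qed

section \<open>Tests from computable sequences of pairs\<close>

lemma martin_loef_random_disagree:
  fixes g h :: "nat \<Rightarrow> nat"
  assumes A: "martin_loef_random A" and g: "total_rec1 g" and h: "total_rec1 h"
    and ne: "\<And>k. g k \<noteq> h k" and mono: "strict_mono (\<lambda>k. max (g k) (h k))"
  shows "\<exists>k. A (g k) \<noteq> A (h k)"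
proof (rule ccontr)
  assume "\<nexists>k. A (g k) \<noteq> A (h k)"
  then have agree: "A (g k) = A (h k)" for k
    by blast
  \<comment> \<open>Requiring both positions inside the string makes membership in
    \<open>W n\<close> decidable; the cylinders still cover every set that agrees on the first
    \<open>n\<close> pairs.\<close>
  define W where "W n = {\<sigma> :: bool list. \<forall>k<n. g k < length \<sigma> \<and> h k < length \<sigma> \<and> \<sigma> ! g k = \<sigma> ! h k}" for n
  define U where "U n = (\<Union>\<sigma>\<in>W n. cylinder \<sigma>)" for n
  have U_eq: "U n = {X :: cantor. \<forall>k<n. X (g k) = X (h k)}" for n
  proof (intro equalityI subsetI)
    fix X
    assume "X \<in> U n"
    then show "X \<in> {X. \<forall>k<n. X (g k) = X (h k)}"
      by (auto simp: U_def W_def cylinder_def)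
  next
    fix X :: cantor
    assume X: "X \<in> {X. \<forall>k<n. X (g k) = X (h k)}"
    \<comment> \<open>By monotonicity this length covers every position of the first
      \<open>n\<close> pairs.\<close>
    define L where "L = Suc (max (g n) (h n))"
    have "g k < L" "h k < L" if "k < n" for k
      using strict_monoD[OF mono that] by (auto simp: L_def)
    with X have "map X [0..<L] \<in> W n"
      by (auto simp: W_def)
    moreover have "X \<in> cylinder (map X [0..<L])"
      by (simp add: cylinder_def)
    ultimately show "X \<in> U n"
      unfolding U_def by blast
  qed
  have "martin_loef_test U"
    unfolding martin_loef_test_def
  proof (intro conjI exI allI)
    show "uniformly_ce W"
      unfolding W_def by (rule uniformly_ce_agree[OF g h])
    show "measure coin_measure (U n) \<le> 1 / 2 ^ n" for n
      unfolding U_eq measure_agree[OF ne mono] ..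
  qed (rule U_def)
  with A have "A \<notin> (\<Inter>n. U n)"
    unfolding martin_loef_random_def by blast
  with agree show False
    by (simp add: U_eq)
qed

text \<open>If the disagreements were unbounded, some computable subsequence of them would have strictly
  increasing maxima.\<close>

lemma martin_loef_random_agree_bounded:
  fixes g h :: "nat \<Rightarrow> nat"
  assumes A: "martin_loef_random A" and g: "total_rec1 g" and h: "total_rec1 h"
    and agree: "\<And>x. A (g x) = A (h x)"
  shows "\<exists>N. \<forall>x. g x \<noteq> h x \<longrightarrow> max (g x) (h x) < N"
proof (rule ccontr)
  assume *: "\<not> ?thesis"
  note comp_g = total_rec_comp1[OF g] and comp_h = total_rec_comp1[OF h]
  \<comment> \<open>The maximum, written with truncated subtraction so that the closure rules
    apply.\<close>
  define M where "M x = g x + (h x - g x)" for x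
  have M: "M x = max (g x) (h x)" for x
    by (simp add: M_def)
  \<comment> \<open>A zero encodes a disagreement with maximum at least \<open>N\<close>, which can
    then be found by search.\<close>
  define Z where "Z x N = (1 - ((g x - h x) + (h x - g x))) + (N - M x)" for x N
  have Z: "Z x N = 0 \<longleftrightarrow> g x \<noteq> h x \<and> N \<le> M x" for x N
    by (auto simp: Z_def)
  have ex: "\<exists>x. Z x N = 0" for N
    using * unfolding Z M by (meson not_less)
  define q where "q N = (LEAST x. Z x N = 0)" for N
  have q: "g (q N) \<noteq> h (q N)" "N \<le> M (q N)" for N
    using LeastI_ex[OF ex[of N]] unfolding Z q_def by auto
  have rec_M: "total_rec k (\<lambda>xs. M (a xs))" if "total_rec k a" for k a
    unfolding M_def by (intro rec_intros comp_g comp_h that)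
  have "total_rec2 Z"
    unfolding Z_def by (intro rec_intros comp_g comp_h rec_M) simp_all
  then have "total_rec1 q"
    unfolding q_def by (intro total_rec1_Least ex)
  note comp_q = total_rec_comp1[OF this]
  \<comment> \<open>Each threshold exceeds the maximum of the pair found for the previous one, so
    the maxima increase strictly.\<close>
  define t where "t k = rec_nat 0 (\<lambda>i r. Suc (M (q r))) k" for k :: nat
  have "total_rec1 t"
    unfolding t_def by (intro total_rec1_rec_nat rec_intros rec_M comp_q) simp_all
  note comp_t = total_rec_comp1[OF this]
  have "strict_mono (\<lambda>k. M (q (t k)))"
  proof (rule strict_monoI_Suc)
    show "M (q (t k)) < M (q (t (Suc k)))" for k
      using q(2)[of "t (Suc k)"] by (simp add: t_def)
  qed
  then have "\<exists>k. A (g (q (t k))) \<noteq> A (h (q (t k)))"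
    by (intro martin_loef_random_disagree[OF A, of "\<lambda>k. g (q (t k))" "\<lambda>k. h (q (t k))"] q
        comp_g comp_h comp_q comp_t rec_intros) (simp_all add: M)
  with agree show False
    by simp
qed

section \<open>The antichain\<close>

text \<open>Every number has one even preimage under \<open>spread i\<close>, and exactly the numbers of 2-adic
  valuation \<open>i\<close> have an additional odd one.\<close>

definition spread :: "nat \<Rightarrow> nat \<Rightarrow> nat" where
  "spread i x = (if even x then x div 2 else 2 ^ i * x)"

lemma computable_spread: "computable (spread i)"
proof -
  \<comment> \<open>The parity \<open>x mod 2\<close> serves as an arithmetic case
    distinction.\<close>
  have "spread i x = (1 - x mod 2) * (x div 2) + x mod 2 * (2 ^ i * x)" for x
  proof (cases "even x")
    case True
    then obtain y where "x = 2 * y" ..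
    then show ?thesis
      by (simp add: spread_def)
  next
    case False
    then obtain y where "x = 2 * y + 1" ..
    then show ?thesis
      by (simp add: spread_def)
  qed
  then have eq: "spread i = (\<lambda>x. (1 - x mod 2) * (x div 2) + x mod 2 * (2 ^ i * x))"
    by (rule ext)
  show ?thesis
    unfolding total_rec1_iff_computable[symmetric] eq by (intro rec_intros) simp_all
qed

lemma computable_double: "computable (\<lambda>x. 2 * x)"
  unfolding total_rec1_iff_computable[symmetric] by (intro rec_intros) simp_all

text \<open>An odd preimage under \<open>spread j\<close> would give the value 2-adic valuation
  \<open>j\<close>, but \<open>2 ^ i * m\<close> has valuation \<open>i\<close>. Only the even
  preimage remains.\<close>

lemma spread_eq_imp_even_preimage:
  assumes "i \<noteq> j" "odd m" "spread j x = 2 ^ i * m"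
  shows "x = 2 * (2 ^ i * m)"
proof (cases "even x")
  case True
  with assms(3) show ?thesis
    by (auto simp: spread_def)
next
  case False
  with assms(3) have eq: "2 ^ j * x = 2 ^ i * m"
    by (simp add: spread_def)
  have "multiplicity 2 (2 ^ k * y) = k" if "odd y" for k and y :: nat
    using that by (intro multiplicity_eqI) simp_all
  from this[of x j] this[of m i] eq False assms(1,2) show ?thesis
    by simp
qed

lemma martin_loef_random_antichain:
  assumes A: "martin_loef_random A"
  shows "\<exists>B :: nat \<Rightarrow> cantor. (\<forall>i. B i \<in> m_degree A) \<and> (\<forall>i j. i \<noteq> j \<longrightarrow> \<not> B i \<le>\<^sub>1 B j)"
proof (intro exI[of _ "\<lambda>i x. A (spread i x)"] conjI allI impI notI)
  fix i
  have "(\<lambda>x. A (spread i x)) \<le>\<^sub>m A"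
    unfolding m_reducible_def using computable_spread by blast
  \<comment> \<open>Doubling selects the even preimages:
    \<open>spread i (2 * x) = x\<close>.\<close>
  moreover have "A \<le>\<^sub>m (\<lambda>x. A (spread i x))"
    unfolding m_reducible_def using computable_double by (force simp: spread_def)
  ultimately show "(\<lambda>x. A (spread i x)) \<in> m_degree A"
    by (simp add: m_degree_def m_equivalent_def)
next
  fix i j :: nat
  assume "i \<noteq> j" and "(\<lambda>x. A (spread i x)) \<le>\<^sub>1 (\<lambda>x. A (spread j x))"
  then obtain f where f: "computable f" "inj f" "\<And>x. A (spread i x) = A (spread j (f x))"
    unfolding one_reducible_def by auto
  have "total_rec1 (\<lambda>x. spread j (f x))"
    by (rule total_rec_comp1) (simp_all only: total_rec1_iff_computable computable_spread f(1))
  then obtain N where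
    N: "\<And>x. spread i x \<noteq> spread j (f x) \<Longrightarrow> max (spread i x) (spread j (f x)) < N"
    using martin_loef_random_agree_bounded[of A "spread i" "\<lambda>x. spread j (f x)", OF A _ _ f(3)]
      computable_spread
    unfolding total_rec1_iff_computable by blast
  \<comment> \<open>The number \<open>v\<close> has valuation \<open>i\<close> and is not below the
    bound. It has the two preimages \<open>m\<close> and \<open>2 * v\<close> under
    \<open>spread i\<close>, but only one under \<open>spread j\<close>.\<close>
  define m where "m = 2 * N + 1"
  define v where "v = 2 ^ i * m"
  have m: "odd m" "N \<le> v"
  proof -
    show "odd m"
      by (simp add: m_def)
    have "1 * m \<le> 2 ^ i * m"
      by (rule mult_right_mono) simp_all
    then show "N \<le> v"
      by (simp add: m_def v_def)
  qed
  \<comment> \<open>As \<open>v\<close> is not below \<open>N\<close>, \<open>spread j (f x)\<close>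
    must equal \<open>v\<close> too.\<close>
  have fx: "f x = 2 * v" if "spread i x = v" for x
    using N[of x] that m spread_eq_imp_even_preimage[OF \<open>i \<noteq> j\<close> m(1), of "f x"]
    by (cases "spread j (f x) = v") (auto simp: v_def[symmetric])
  have "spread i m = v" "spread i (2 * v) = v"
    using m by (simp_all add: spread_def v_def)
  \<comment> \<open>Both preimages go to \<open>2 * v\<close>; injectivity then equates the odd
    \<open>m\<close> with an even number.\<close>
  then have "f m = f (2 * v)"
    using fx by simp
  then have "m = 2 * v"
    using f(2) by (simp add: inj_eq)
  with m show False
    by simp
qed

section \<open>Almost every set is random\<close>

instance recf :: countable
  by countable_datatype

text \<open>Every test arises in this way from a program, and there are only countably many
  programs.\<close>

definition ce_open :: "recf \<Rightarrow> nat \<Rightarrow> cantor set" where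
  "ce_open e n = (\<Union>\<sigma>\<in>{\<sigma>. eval e [n, list_encode (map of_bool \<sigma>)] \<noteq> None}. cylinder \<sigma>)"

lemma martin_loef_test_eq_ce_open:
  assumes "martin_loef_test U"
  shows "\<exists>e. U = ce_open e"
proof -
  obtain W e where W: "\<And>n. U n = (\<Union>\<sigma>\<in>W n. cylinder \<sigma>)"
    and e: "\<And>n \<sigma>. \<sigma> \<in> W n \<longleftrightarrow> eval e [n, list_encode (map of_bool \<sigma>)] \<noteq> None"
    using assms unfolding martin_loef_test_def uniformly_ce_def by blast
  have "W n = {\<sigma>. eval e [n, list_encode (map of_bool \<sigma>)] \<noteq> None}" for n
    using e by blast
  then have "U n = ce_open e n" for n
    unfolding W ce_open_def by simp
  then show ?thesis
    by blast
qed

lemma AE_not_in_martin_loef_test: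
  assumes U: "martin_loef_test U"
  shows "AE X in coin_measure. X \<notin> (\<Inter>n. U n)"
proof -
  interpret prob_space coin_measure
    by (rule prob_space_coin_measure)
  obtain e where e: "U = ce_open e"
    using martin_loef_test_eq_ce_open[OF U] by blast
  \<comment> \<open>There are only countably many strings, so the union of cylinders is
    measurable.\<close>
  have sets: "U n \<in> sets coin_measure" for n
    unfolding e ce_open_def by (intro sets.countable_UN'' sets_cylinder) simp_all
  have "measure coin_measure (\<Inter>n. U n) \<le> (1 / 2) ^ n" for n
  proof -
    have "measure coin_measure (\<Inter>n. U n) \<le> measure coin_measure (U n)"
      by (rule finite_measure_mono) (auto intro: sets)
    also have "\<dots> \<le> (1 / 2) ^ n"
      using U unfolding martin_loef_test_def by (simp add: power_divide)
    finally show ?thesis .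
  qed
  then have "measure coin_measure (\<Inter>n. U n) \<le> 0"
    by (intro LIMSEQ_le_const[OF LIMSEQ_power_zero[of "1 / 2 :: real"]]) auto
  then have "measure coin_measure (\<Inter>n. U n) = 0"
    using measure_nonneg[of coin_measure] by (rule antisym)
  moreover have "(\<Inter>n. U n) \<in> sets coin_measure"
    using sets.top[of coin_measure] by (intro sets.countable_INT'') (simp_all add: sets)
  ultimately have "(\<Inter>n. U n) \<in> null_sets coin_measure"
    by (simp add: null_sets_def emeasure_eq_measure)
  then show ?thesis
    by (rule AE_not_in)
qed

lemma AE_martin_loef_random: "AE X in coin_measure. martin_loef_random X"
proof -
  \<comment> \<open>Over a countable type, \<open>AE\<close> commutes with the universal quantifier.
    Being a test stays a premise, since a program may violate the measure bound.\<close>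
  have "AE X in coin_measure. \<forall>e. martin_loef_test (ce_open e) \<longrightarrow> X \<notin> (\<Inter>n. ce_open e n)"
    unfolding AE_all_countable using AE_not_in_martin_loef_test by (auto simp: AE_impI)
  then show ?thesis
  proof (rule AE_mp, intro AE_I2 impI)
    fix X
    assume "\<forall>e. martin_loef_test (ce_open e) \<longrightarrow> X \<notin> (\<Inter>n. ce_open e n)"
    then show "martin_loef_random X"
      unfolding martin_loef_random_def using martin_loef_test_eq_ce_open by blast
  qed
qed

theorem corollary4p2:
  shows "(AE A in coin_measure.
            \<exists>B :: nat \<Rightarrow> cantor. (\<forall>i. B i \<in> m_degree A) \<and> (\<forall>i j. i \<noteq> j \<longrightarrow> \<not> B i \<le>\<^sub>1 B j))
       \<and> (\<forall>A. martin_loef_random A \<longrightarrow>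
            (\<exists>B :: nat \<Rightarrow> cantor. (\<forall>i. B i \<in> m_degree A) \<and> (\<forall>i j. i \<noteq> j \<longrightarrow> \<not> B i \<le>\<^sub>1 B j)))"
proof (intro conjI allI impI)
  show "AE A in coin_measure.
      \<exists>B :: nat \<Rightarrow> cantor. (\<forall>i. B i \<in> m_degree A) \<and> (\<forall>i j. i \<noteq> j \<longrightarrow> \<not> B i \<le>\<^sub>1 B j)"
    using AE_martin_loef_random by (rule AE_mp) (simp add: martin_loef_random_antichain)
qed (rule martin_loef_random_antichain)

end
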